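(* Let $n\ge1$. The distribution of the number of descents on $\mathcal{C}_n$ is symmetric, in the sense that $$|\{\pi\in\mathcal{C}_n:\mathrm{des}(\pi)=r\}|=|\{\pi\in\mathcal{C}_n:\mathrm{des}(\pi)=2n-2-r\}|$$ for all integers $r$.
   Context: Let $[n]=\{1,\dots,n\}$ and let $[n]\sqcup[n]=\{1,1,2,2,\dots,n,n\}$ be the multiset with two copies of each element of $[n]$. A permutation $\pi=\pi_1\pi_2\dots\pi_{2n}$ of $[n]\sqcup[n]$ is nonnesting if there do not exist $i<j<\ell<m$ with $\pi_i=\pi_m$ and $\pi_j=\pi_\ell$; $\mathcal{C}_n$ denotes the set of nonnesting permutations of $[n]\sqcup[n]$. For $\pi\in\mathcal{C}_n$, $\mathrm{des}(\pi)=|\{i\in[2n-1]:\pi_i>\pi_{i+1}\}|$ is its number of descents. *)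

theory Defs
  imports "HOL-Combinatorics.Multiset_Permutations"
begin

text \<open>
  A permutation of a multiset of numbers is written as a word, i.e. a list; list positions are
  counted from 0, so the letter $\pi_i$ is \<open>\<pi> ! (i - 1)\<close>.
\<close>

definition two_copies :: "nat \<Rightarrow> nat multiset" where
  "two_copies n = mset_set {1..n} + mset_set {1..n}"

definition nonnesting :: "'a list \<Rightarrow> bool" where
  "nonnesting \<pi> \<longleftrightarrow>
     \<not> (\<exists>i j l m. i < j \<and> j < l \<and> l < m \<and> m < length \<pi> \<and> \<pi> ! i = \<pi> ! m \<and> \<pi> ! j = \<pi> ! l)"

definition nonnesting_perms :: "nat \<Rightarrow> nat list set" where
  "nonnesting_perms n = {\<pi> \<in> permutations_of_multiset (two_copies n). nonnesting \<pi>}"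

definition des :: "'a::linorder list \<Rightarrow> nat" where
  "des \<pi> = card {i. Suc i < length \<pi> \<and> \<pi> ! i > \<pi> ! Suc i}"

end

theory Submission
  imports Defs "HOL-Library.Product_Lexorder" "HOL-Library.FuncSet"
begin

text \<open>
  The number of weak descents (\<open>\<pi>\<^sub>i \<ge> \<pi>\<^bsub>i+1\<^esub>\<close>) is distributed like
  \<open>des + 1\<close>; the symmetry follows, since complementing the letters turns the
  weak descents into the positions that are not descents.

  The equidistribution is a P-partition argument.  Cut a nonnesting permutation by bars into blocks,
  with a bar at least at every descent.  Sorting shows that such a barred word with
  \<open>m\<close> bars is the same thing as a choice of blocks \<open>a\<^sub>x \<le> b\<^sub>x \<le> m\<close>
  for the two copies of each letter \<open>x\<close>, such that the pairs
  \<open>(a\<^sub>x, x)\<close> and \<open>(b\<^sub>x, x)\<close> are in the same lexicographic order.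
  If bars are required at all weak descents, the condition becomes
  \<open>a\<^sub>x < b\<^sub>x\<close>, and lowering every \<open>b\<^sub>x\<close> by one
  returns to the first kind with \<open>m - 1\<close> bars.  The number of ways to
  insert the bars depends only on the number of forced ones, in a triangular fashion.
\<close>

section \<open>Descents with respect to an arbitrary relation, and barred words\<close>

definition des_by :: "('a \<Rightarrow> 'a \<Rightarrow> bool) \<Rightarrow> 'a list \<Rightarrow> nat" where
  "des_by R xs = card {i. Suc i < length xs \<and> R (xs ! i) (xs ! Suc i)}"

lemma des_by_Nil [simp]: "des_by R [] = 0"
  and des_by_single [simp]: "des_by R [x] = 0"
  by (simp_all add: des_by_def)

lemma des_by_Cons_Cons [simp]:
  "des_by R (x # y # ys) = (if R x y then 1 else 0) + des_by R (y # ys)"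
proof -
  let ?S = "{i. Suc i < length (y # ys) \<and> R ((y # ys) ! i) ((y # ys) ! Suc i)}"
  have "{i. Suc i < length (x # y # ys) \<and> R ((x # y # ys) ! i) ((x # y # ys) ! Suc i)}
      = (if R x y then {0} else {}) \<union> Suc ` ?S" (is "?L = ?R")
  proof (rule set_eqI)
    fix i show "i \<in> ?L \<longleftrightarrow> i \<in> ?R" by (cases i) auto
  qed
  moreover have "finite ?S" by (rule finite_subset[of _ "{..<length (y # ys)}"]) auto
  moreover have "(if R x y then {0} else {}) \<inter> Suc ` ?S = {}" by auto
  ultimately show ?thesis
    unfolding des_by_def by (simp add: card_Un_disjoint card_image)
qed

lemma des_by_compl: "des_by (\<lambda>x y. \<not> R x y) xs + des_by R xs = length xs - 1"
  by (induction xs rule: induct_list012) auto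

lemma des_by_map: "des_by R (map f xs) = des_by (\<lambda>x y. R (f x) (f y)) xs"
  by (induction xs rule: induct_list012) auto

text \<open>The first component of an entry is the number of bars to its left, so a bar is forced
  wherever \<open>R\<close> holds between neighbours. The lower bound \<open>c\<close> serves the
  recursion on the word; the words of interest have \<open>c = 0\<close>.\<close>

definition barred :: "('a \<Rightarrow> 'a \<Rightarrow> bool) \<Rightarrow> 'a list \<Rightarrow> nat \<Rightarrow> nat \<Rightarrow> (nat \<times> 'a) list set" where
  "barred R xs c m = {z. map snd z = xs \<and> (\<forall>p\<in>set z. c \<le> fst p \<and> fst p \<le> m) \<and>
     successively (\<lambda>p q. fst p < fst q \<or> fst p = fst q \<and> \<not> R (snd p) (snd q)) z}"

lemma finite_barred: "finite (barred R xs c m)"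
proof (rule finite_subset)
  show "barred R xs c m \<subseteq> {z. set z \<subseteq> {..m} \<times> set xs \<and> length z = length xs}"
    by (force simp: barred_def)
  show "finite {z. set z \<subseteq> {..m} \<times> set xs \<and> length z = length xs}"
    by (rule finite_lists_length_eq) simp
qed

lemma barred_Nil: "barred R [] c m = {[]}"
  by (auto simp: barred_def)

lemma barred_empty: "m < c \<Longrightarrow> barred R (x # xs) c m = {}"
  by (force simp: barred_def)

lemma barred_single_step:
  "c \<le> m \<Longrightarrow> barred R [x] c m = insert [(c, x)] (barred R [x] (Suc c) m)"
  by (auto simp: barred_def le_Suc_eq)

lemma successively_bar_fst_ge:
  assumes "successively (\<lambda>p q. fst p < fst q \<or> fst p = fst q \<and> \<not> R (snd p) (snd q)) (p # z)"
    and "q \<in> set z"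
  shows "fst p \<le> (fst q :: nat)"
  using assms
proof (induction z arbitrary: p)
  case (Cons r z)
  have "fst p \<le> fst r" using Cons.prems by auto
  moreover have "fst r \<le> fst q"
  proof (cases "q = r")
    case False
    then show ?thesis using Cons.prems by (intro Cons.IH) auto
  qed simp
  ultimately show ?case by simp
qed simp

lemma barred_step:
  assumes "c \<le> m"
  shows "barred R (x # y # ys) c m = Cons (c, x) ` barred R (y # ys) (c + (if R x y then 1 else 0)) m
    \<union> barred R (x # y # ys) (Suc c) m" (is "?L = ?A \<union> ?B")
proof (intro equalityI subsetI)
  fix z assume z: "z \<in> ?L"
  then obtain k l zs where [simp]: "z = (k, x) # (l, y) # zs"
    by (auto simp: barred_def)
  let ?Q = "\<lambda>p q. fst p < fst q \<or> fst p = fst q \<and> \<not> R (snd p) (snd q)"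
  have suc: "successively ?Q ((k, x) # (l, y) # zs)" and ms: "map snd zs = ys"
    and bd: "\<forall>p\<in>set z. c \<le> fst p \<and> fst p \<le> m"
    using z by (auto simp: barred_def)
  \<comment> \<open>Only neighbours are constrained, so bounds on the second entry must be carried
    to all later ones.\<close>
  have ge: "\<forall>q\<in>set zs. l \<le> fst q"
    using successively_bar_fst_ge[of R "(l, y)" zs] suc by auto
  show "z \<in> ?A \<union> ?B"
  proof (cases "k = c")
    case True
    have "(l, y) # zs \<in> barred R (y # ys) (c + (if R x y then 1 else 0)) m"
      using suc ms bd ge True by (fastforce simp: barred_def)
    then show ?thesis using True by auto
  next
    case False
    then have "z \<in> ?B"
      using suc ms bd ge by (fastforce simp: barred_def)
    then show ?thesis ..
  qed
next
  fix z assume "z \<in> ?A \<union> ?B"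
  then show "z \<in> ?L"
  proof
    assume "z \<in> ?A"
    then obtain l zs where "z = (c, x) # (l, y) # zs"
      "(l, y) # zs \<in> barred R (y # ys) (c + (if R x y then 1 else 0)) m"
      by (force simp: barred_def)
    then show ?thesis using assms by (auto simp: barred_def split: if_splits)
  next
    assume "z \<in> ?B"
    then show ?thesis by (auto simp: barred_def)
  qed
qed

text \<open>Subtracting the number of forced bars passed so far leaves an arbitrary weakly
  increasing sequence over \<open>Suc m - c - des_by R xs\<close> values, so this is the multiset
  coefficient. The proof is an outer induction on the word and an inner one on the number of
  available blocks.\<close>

lemma card_barred:
  "card (barred R xs c m) = (Suc m - c - des_by R xs + length xs - 1) choose length xs"
proof (induction xs arbitrary: c rule: induct_list012)
  case 1
  then show ?case by (simp add: barred_Nil)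
next
  case (2 x)
  show ?case
  proof (induction "Suc m - c" arbitrary: c)
    case 0
    then show ?case by (simp add: barred_empty)
  next
    case (Suc d)
    have "[(c, x)] \<notin> barred R [x] (Suc c) m" by (simp add: barred_def)
    then show ?case
      using Suc(1)[of "Suc c"] Suc(2)
      by (simp add: barred_single_step finite_barred)
  qed
next
  case (3 x y ys)
  let ?e = "if R x y then 1 else 0 :: nat"
  show ?case
  proof (induction "Suc m - c" arbitrary: c)
    case 0
    then show ?case by (simp add: barred_empty)
  next
    case (Suc d)
    then have cm: "c \<le> m" by simp
    have "card (barred R (x # y # ys) c m)
        = card (barred R (y # ys) (c + ?e) m) + card (barred R (x # y # ys) (Suc c) m)"
      unfolding barred_step[OF cm]
      by (subst card_Un_disjoint) (simp_all add: finite_barred card_image, auto simp: barred_def)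
    also have "\<dots> = (Suc m - (c + ?e) - des_by R (y # ys) + length (y # ys) - 1 choose length (y # ys))
       + (Suc m - Suc c - des_by R (x # y # ys) + length (x # y # ys) - 1 choose length (x # y # ys))"
      using "3.IH"(2)[of "c + ?e"] Suc(1)[of "Suc c"] Suc(2) by simp
    also have "\<dots> = (Suc m - c - des_by R (x # y # ys) + length (x # y # ys) - 1
        choose length (x # y # ys))"
    \<comment> \<open>With no value left, truncated subtraction turns every term into some
      \<open>l - 1 choose l\<close>, which is 0 for l > 0; otherwise this is Pascal's rule.\<close>
    proof (cases "Suc m - c - des_by R (x # y # ys)")
      case 0
      then have "Suc m - (c + ?e) - des_by R (y # ys) = 0"
        "Suc m - Suc c - des_by R (x # y # ys) = 0" by auto
      then show ?thesis unfolding 0 by simp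
    next
      case (Suc k)
      then have "Suc m - (c + ?e) - des_by R (y # ys) = Suc k"
        "Suc m - Suc c - des_by R (x # y # ys) = k" by auto
      then show ?thesis unfolding Suc by simp
    qed
    finally show ?case .
  qed
qed

section \<open>Recovering a distribution from weighted sums\<close>

lemma sum_by_value:
  fixes G :: "nat \<Rightarrow> nat"
  assumes "finite C" and "G 0 = 0"
  shows "(\<Sum>x\<in>C. G (Suc m - \<alpha> x)) = (\<Sum>k\<le>m. card {x \<in> C. \<alpha> x = k} * G (Suc m - k))"
proof -
  \<comment> \<open>Elements with \<open>\<alpha> x > m\<close> contribute \<open>G 0 = 0\<close> by
    truncated subtraction.\<close>
  have "(\<Sum>x\<in>C. G (Suc m - \<alpha> x)) = (\<Sum>x\<in>{x\<in>C. \<alpha> x \<le> m}. G (Suc m - \<alpha> x))"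
    using assms by (intro sum.mono_neutral_right) (auto simp: not_le Suc_le_eq[symmetric])
  also have "\<dots> = (\<Sum>k\<le>m. \<Sum>x\<in>{x \<in> {x\<in>C. \<alpha> x \<le> m}. \<alpha> x = k}. G (Suc m - \<alpha> x))"
    using assms by (intro sum.group[symmetric]) auto
  also have "\<dots> = (\<Sum>k\<le>m. card {x \<in> C. \<alpha> x = k} * G (Suc m - k))"
  proof (rule sum.cong)
    fix k assume "k \<in> {..m}"
    then have "{x \<in> {x\<in>C. \<alpha> x \<le> m}. \<alpha> x = k} = {x \<in> C. \<alpha> x = k}" by auto
    then show "(\<Sum>x\<in>{x \<in> {x\<in>C. \<alpha> x \<le> m}. \<alpha> x = k}. G (Suc m - \<alpha> x))
      = card {x \<in> C. \<alpha> x = k} * G (Suc m - k)" by simp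
  qed simp
  finally show ?thesis .
qed

text \<open>The sums form a triangular system in the numbers of elements with a given value, with
  diagonal entry \<open>G 1 = 1\<close>. The equation for \<open>m = r\<close> determines the count
  at \<open>r\<close> from the smaller ones.\<close>

lemma equidistributed_if_sums_eq:
  fixes G :: "nat \<Rightarrow> nat"
  assumes C: "finite C" and G: "G 0 = 0" "G 1 = 1"
    and eq: "\<And>m. (\<Sum>x\<in>C. G (Suc m - \<alpha> x)) = (\<Sum>x\<in>C. G (Suc m - \<beta> x))"
  shows "card {x \<in> C. \<alpha> x = r} = card {x \<in> C. \<beta> x = r}"
proof (induction r rule: less_induct)
  case (less r)
  have "(\<Sum>k\<le>r. card {x \<in> C. \<alpha> x = k} * G (Suc r - k))
      = (\<Sum>k\<le>r. card {x \<in> C. \<beta> x = k} * G (Suc r - k))"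
    using eq[of r] by (simp add: sum_by_value C G)
  moreover have "(\<Sum>k<r. card {x \<in> C. \<alpha> x = k} * G (Suc r - k))
      = (\<Sum>k<r. card {x \<in> C. \<beta> x = k} * G (Suc r - k))"
    by (rule sum.cong) (simp_all add: less)
  ultimately show ?case using G by (simp add: lessThan_Suc_atMost[symmetric])
qed

section \<open>Placements of the letters into blocks\<close>

text \<open>A function \<open>c\<close> places the two copies of \<open>x\<close> in the blocks \<open>fst (c x) \<le> snd (c x)\<close>.\<close>

definition placed :: "nat \<Rightarrow> (nat \<Rightarrow> nat \<times> nat) \<Rightarrow> (nat \<times> nat) multiset" where
  "placed n c = (\<Sum>x\<in>{1..n}. {#(fst (c x), x), (snd (c x), x)#})"

text \<open>The last condition forbids, in the sorted word, a pattern x y y x. Values outside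
  \<open>{1..n}\<close> are fixed by extensionality, so that distinct placements differ on some
  letter.\<close>

definition placements :: "nat \<Rightarrow> nat \<Rightarrow> (nat \<Rightarrow> nat \<times> nat) set" where
  "placements n m = {c \<in> {1..n} \<rightarrow>\<^sub>E UNIV. (\<forall>x\<in>{1..n}. fst (c x) \<le> snd (c x) \<and> snd (c x) \<le> m) \<and>
     (\<forall>x\<in>{1..n}. \<forall>y\<in>{1..n}. \<not> ((fst (c x), x) < (fst (c y), y) \<and> (snd (c y), y) < (snd (c x), x)))}"

text \<open>Lexicographic order means that blocks come in order and letters weakly increase within a
  block: bars stand at least at every descent.\<close>

definition sorted_barred :: "nat \<Rightarrow> nat \<Rightarrow> (nat \<times> nat) list set" where
  "sorted_barred n m = {z. sorted z \<and> (\<forall>p\<in>set z. fst p \<le> m) \<and> map snd z \<in> nonnesting_perms n}"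

lemma two_copies_eq_sum: "two_copies n = (\<Sum>x\<in>{1..n}. {#x, x#})"
proof -
  have "mset_set A = (\<Sum>x\<in>A. {#x#})" if "finite A" for A :: "nat set"
    using that by (induction A rule: finite_induct) auto
  from this[of "{1..n}"] have "two_copies n = (\<Sum>x\<in>{1..n}. {#x#}) + (\<Sum>x\<in>{1..n}. {#x#})"
    unfolding two_copies_def by simp
  also have "\<dots> = (\<Sum>x\<in>{1..n}. {#x#} + {#x#})" by (rule sum.distrib[symmetric])
  finally show ?thesis by simp
qed

lemma filter_mset_sum: "filter_mset P (\<Sum>x\<in>A. f x) = (\<Sum>x\<in>A. filter_mset P (f x))"
  by (induction A rule: infinite_finite_induct) auto

lemma image_mset_sum: "image_mset g (\<Sum>x\<in>A. f x) = (\<Sum>x\<in>A. image_mset g (f x))"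
  by (induction A rule: infinite_finite_induct) auto

lemma filter_placed:
  assumes "x \<in> {1..n}"
  shows "filter_mset (\<lambda>p. snd p = x) (placed n c) = {#(fst (c x), x), (snd (c x), x)#}"
proof -
  have "filter_mset (\<lambda>p. snd p = x) (placed n c)
      = (\<Sum>y\<in>{1..n}. if y = x then {#(fst (c x), x), (snd (c x), x)#} else {#})"
    unfolding placed_def filter_mset_sum by (rule sum.cong) auto
  then show ?thesis using assms by simp
qed

lemma image_snd_placed: "image_mset snd (placed n c) = two_copies n"
  by (simp add: placed_def image_mset_sum two_copies_eq_sum)

lemma set_placed: "set_mset (placed n c) = (\<Union>x\<in>{1..n}. {(fst (c x), x), (snd (c x), x)})"
  unfolding placed_def by (subst set_mset_sum) auto

lemma mset_eq_sum_filter_snd: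
  assumes "finite A" and "snd ` set_mset M \<subseteq> A"
  shows "M = (\<Sum>x\<in>A. filter_mset (\<lambda>p. snd p = x) M)"
proof (rule multiset_eqI)
  fix p
  have "count (\<Sum>x\<in>A. filter_mset (\<lambda>p. snd p = x) M) p = (\<Sum>x\<in>A. if snd p = x then count M p else 0)"
    unfolding count_sum by (rule sum.cong) auto
  also have "\<dots> = count M p" using assms by (cases "p \<in># M") (auto simp: not_in_iff)
  finally show "count M p = count (\<Sum>x\<in>A. filter_mset (\<lambda>p. snd p = x) M) p" ..
qed

lemma filter_eq_two_positions:
  assumes "filter P z = [u, v]"
  obtains i j where "i < j" "j < length z" "z ! i = u" "z ! j = v"
    "\<And>k. k < length z \<Longrightarrow> P (z ! k) \<Longrightarrow> k = i \<or> k = j"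
proof -
  obtain us w where z: "z = us @ u # w" "\<forall>x\<in>set us. \<not> P x" "filter P w = [v]"
    using assms filter_eq_Cons_iff[of P z u "[v]"] by fastforce
  then obtain vs ws where w: "w = vs @ v # ws" "\<forall>x\<in>set vs. \<not> P x" "\<forall>x\<in>set ws. \<not> P x"
    using filter_eq_Cons_iff[of P w v "[]"] filter_empty_conv[of P] by metis
  show thesis
  proof (rule that[of "length us" "Suc (length us + length vs)"])
    fix k assume "k < length z" "P (z ! k)"
    then show "k = length us \<or> k = Suc (length us + length vs)"
      using z w by (auto simp: nth_append nth_Cons split: if_splits nat.splits)
  qed (auto simp: z w nth_append)
qed

lemma sorted_mset_pair:
  fixes u v :: "'a::linorder"
  assumes "sorted xs" "mset xs = {#u, v#}" "u \<le> v"
  shows "xs = [u, v]"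
  using properties_for_sort[of xs "[u, v]"] assms by simp

text \<open>In a sorted word, entries with different letters are ordered by position exactly as
  lexicographically, so a nesting of positions is a nesting of the pairs.\<close>

lemma nonnesting_iff_placement:
  assumes srt: "sorted z" and M: "mset z = placed n c"
    and le: "\<forall>x\<in>{1..n}. fst (c x) \<le> snd (c x)"
  shows "nonnesting (map snd z) \<longleftrightarrow> (\<forall>x\<in>{1..n}. \<forall>y\<in>{1..n}.
     \<not> ((fst (c x), x) < (fst (c y), y) \<and> (snd (c y), y) < (snd (c x), x)))"
proof -
  have fil: "filter (\<lambda>p. snd p = x) z = [(fst (c x), x), (snd (c x), x)]" if "x \<in> {1..n}" for x
  proof (rule sorted_mset_pair)
    show "sorted (filter (\<lambda>p. snd p = x) z)" using srt by (rule sorted_filter[of id, simplified])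
    show "mset (filter (\<lambda>p. snd p = x) z) = {#(fst (c x), x), (snd (c x), x)#}"
      using filter_placed[OF that] by (simp add: M)
  qed (use le that in auto)
  have "\<exists>i j. i < j \<and> j < length z \<and> z ! i = (fst (c x), x) \<and> z ! j = (snd (c x), x) \<and>
    (\<forall>k < length z. snd (z ! k) = x \<longrightarrow> k = i \<or> k = j)" if "x \<in> {1..n}" for x
    by (rule filter_eq_two_positions[OF fil[OF that]]) blast
  \<comment> \<open>\<open>p x\<close> and \<open>q x\<close> are the positions of the first and
    second copy of \<open>x\<close>.\<close>
  then obtain p q where pq: "\<And>x. x \<in> {1..n} \<Longrightarrow> p x < q x \<and> q x < length z \<and>
      z ! p x = (fst (c x), x) \<and> z ! q x = (snd (c x), x) \<and>
      (\<forall>k < length z. snd (z ! k) = x \<longrightarrow> k = p x \<or> k = q x)"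
    by metis
  have at: "z ! p x = (fst (c x), x)" "z ! q x = (snd (c x), x)"
    and lt: "p x < q x" "q x < length z" "p x < length z" if "x \<in> {1..n}" for x
    using pq[OF that] by auto
  have pos: "k = p x \<or> k = q x" if "x \<in> {1..n}" "k < length z" "snd (z ! k) = x" for k x
    using pq[OF that(1)] that(2,3) by blast
  have less: "i < j" if "z ! i < z ! j" "i < length z" for i j
    using sorted_nth_mono[OF srt, of j i] that by (meson leD leI)
  \<comment> \<open>Distinct letters are required because both copies of a letter may share a block
    and then give equal entries.\<close>
  have less': "z ! i < z ! j" if "i < j" "j < length z" "snd (z ! i) \<noteq> snd (z ! j)" for i j
    using sorted_nth_mono[OF srt, of i j] that by (metis less_imp_le order_le_less)
  have letter: "snd (z ! i) \<in> {1..n}" if "i < length z" for i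
  proof -
    have "z ! i \<in># placed n c" using that by (simp flip: M)
    then show ?thesis by (auto simp: set_placed)
  qed
  show ?thesis
  proof
    assume nn: "nonnesting (map snd z)"
    show "\<forall>x\<in>{1..n}. \<forall>y\<in>{1..n}.
      \<not> ((fst (c x), x) < (fst (c y), y) \<and> (snd (c y), y) < (snd (c x), x))"
    proof (intro ballI notI)
      fix x y assume x: "x \<in> {1..n}" and y: "y \<in> {1..n}"
        and *: "(fst (c x), x) < (fst (c y), y) \<and> (snd (c y), y) < (snd (c x), x)"
      have "z ! p x < z ! p y" "z ! q y < z ! q x" unfolding at[OF x] at[OF y] using * by auto
      then have "p x < p y" "q y < q x" using less lt x y by blast+
      moreover have "map snd z ! p x = map snd z ! q x" "map snd z ! p y = map snd z ! q y"
        using at[OF x] at[OF y] lt[OF x] lt[OF y] by simp_all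
      ultimately show False
        using nn lt[OF x] lt[OF y] unfolding nonnesting_def length_map by blast
    qed
  next
    assume nn: "\<forall>x\<in>{1..n}. \<forall>y\<in>{1..n}.
      \<not> ((fst (c x), x) < (fst (c y), y) \<and> (snd (c y), y) < (snd (c x), x))"
    show "nonnesting (map snd z)"
      unfolding nonnesting_def
    proof (clarsimp)
      fix i j l m
      assume ij: "i < j" "j < l" "l < m" "m < length z"
        and im: "snd (z ! i) = snd (z ! m)" and jl: "snd (z ! j) = snd (z ! l)"
      define x y where "x = snd (z ! i)" and "y = snd (z ! j)"
      have len: "i < length z" "j < length z" "l < length z" using ij by auto
      have x: "x \<in> {1..n}" and y: "y \<in> {1..n}" using letter len by (simp_all add: x_def y_def)
      have snds: "snd (z ! i) = x" "snd (z ! m) = x" "snd (z ! j) = y" "snd (z ! l) = y"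
        using im jl by (simp_all add: x_def y_def)
      have xi: "i = p x" "m = q x"
        using pos[OF x len(1) snds(1)] pos[OF x ij(4) snds(2)] lt[OF x] ij by linarith+
      have yi: "j = p y" "l = q y"
        using pos[OF y len(2) snds(3)] pos[OF y len(3) snds(4)] lt[OF y] ij by linarith+
      \<comment> \<open>Equal letters would force \<open>i = j\<close>, both being the first
        position.\<close>
      have ne: "x \<noteq> y" using xi yi ij by blast
      have "z ! i < z ! j" using ij len snds ne by (intro less') simp_all
      moreover have "z ! l < z ! m" using ij snds ne by (intro less') simp_all
      ultimately have "(fst (c x), x) < (fst (c y), y)" "(snd (c y), y) < (snd (c x), x)"
        unfolding xi yi at[OF x] at[OF y] .
      then show False using nn x y by blast
    qed
  qed
qed

text \<open>The inverse reads off, for each letter, the blocks of its two copies in a sorted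
  word.\<close>

lemma bij_betw_placements:
  "bij_betw (\<lambda>c. sorted_list_of_multiset (placed n c)) (placements n m) (sorted_barred n m)"
proof (rule bij_betwI')
  fix c d assume c: "c \<in> placements n m" and d: "d \<in> placements n m"
  show "sorted_list_of_multiset (placed n c) = sorted_list_of_multiset (placed n d) \<longleftrightarrow> c = d"
  proof
    assume "sorted_list_of_multiset (placed n c) = sorted_list_of_multiset (placed n d)"
    then have eq: "placed n c = placed n d" by (metis mset_sorted_list_of_multiset)
    show "c = d"
    proof (rule PiE_ext)
      show "c \<in> {1..n} \<rightarrow>\<^sub>E UNIV" "d \<in> {1..n} \<rightarrow>\<^sub>E UNIV" using c d by (auto simp: placements_def)
      fix x assume x: "x \<in> {1..n}"
      then have "{#(fst (c x), x), (snd (c x), x)#} = {#(fst (d x), x), (snd (d x), x)#}"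
        using filter_placed[OF x] eq by metis
      moreover have "fst (c x) \<le> snd (c x)" "fst (d x) \<le> snd (d x)"
        using c d x by (auto simp: placements_def)
      \<comment> \<open>The order of the two blocks recovers the pair from the multiset.\<close>
      ultimately show "c x = d x" by (auto simp: add_eq_conv_ex prod_eq_iff)
    qed
  qed simp
next
  fix c assume c: "c \<in> placements n m"
  let ?z = "sorted_list_of_multiset (placed n c)"
  have srt: "sorted ?z" by simp
  have M: "mset ?z = placed n c" by simp
  have le: "\<forall>x\<in>{1..n}. fst (c x) \<le> snd (c x) \<and> snd (c x) \<le> m"
    using c by (auto simp: placements_def)
  have "nonnesting (map snd ?z)"
    using nonnesting_iff_placement[OF srt M] c le by (auto simp: placements_def)
  moreover have "\<forall>p\<in>set ?z. fst p \<le> m"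
    using le by (fastforce simp: set_placed)
  ultimately show "?z \<in> sorted_barred n m"
    by (simp add: sorted_barred_def nonnesting_perms_def permutations_of_multiset_def image_snd_placed)
next
  fix z assume z: "z \<in> sorted_barred n m"
  then have srt: "sorted z" and bd: "\<forall>p\<in>set z. fst p \<le> m" and nn: "nonnesting (map snd z)"
    and ms: "mset (map snd z) = two_copies n"
    by (auto simp: sorted_barred_def nonnesting_perms_def permutations_of_multiset_def)
  have "\<exists>r. filter (\<lambda>p. snd p = x) z = [(fst r, x), (snd r, x)]" if "x \<in> {1..n}" for x
  proof -
    have "length (filter (\<lambda>p. snd p = x) z) = count (mset (map snd z)) x"
      by (induction z) auto
    also have "\<dots> = 2" unfolding ms using that by (simp add: two_copies_def)
    finally obtain u v where uv: "filter (\<lambda>p. snd p = x) z = [u, v]"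
      by (auto simp: length_Suc_conv numeral_2_eq_2)
    then have "set (filter (\<lambda>p. snd p = x) z) = {u, v}" by simp
    then have "snd u = x \<and> snd v = x" by (auto dest: arg_cong[of _ _ set])
    then show ?thesis using uv by (intro exI[of _ "(fst u, fst v)"]) (auto simp: prod_eq_iff)
  qed
  then obtain c0 where c0: "\<And>x. x \<in> {1..n} \<Longrightarrow>
      filter (\<lambda>p. snd p = x) z = [(fst (c0 x), x), (snd (c0 x), x)]" by metis
  define c where "c = restrict c0 {1..n}"
  have c: "filter (\<lambda>p. snd p = x) z = [(fst (c x), x), (snd (c x), x)]" if "x \<in> {1..n}" for x
    using c0[OF that] that by (simp add: c_def)
  have letters: "snd ` set_mset (mset z) \<subseteq> {1..n}"
  proof -
    have "set_mset (mset (map snd z)) = {1..n}" unfolding ms two_copies_def by simp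
    then show ?thesis by simp
  qed
  have M: "mset z = placed n c"
    unfolding placed_def
    by (subst mset_eq_sum_filter_snd[OF _ letters])
      (auto intro!: sum.cong simp: c simp flip: mset_filter)
  have le: "fst (c x) \<le> snd (c x) \<and> snd (c x) \<le> m" if x: "x \<in> {1..n}" for x
  proof -
    have "sorted (filter (\<lambda>p. snd p = x) z)" using srt by (rule sorted_filter[of id, simplified])
    then have "fst (c x) \<le> snd (c x)" unfolding c[OF x] by auto
    moreover have "(snd (c x), x) \<in> set (filter (\<lambda>p. snd p = x) z)" by (simp add: c[OF x])
    then have "snd (c x) \<le> m" using bd by auto
    ultimately show ?thesis ..
  qed
  have "c \<in> placements n m"
    using nonnesting_iff_placement[OF srt M] nn le by (auto simp: placements_def c_def)
  moreover have "z = sorted_list_of_multiset (placed n c)"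
    using srt by (metis M sorted_list_of_multiset_mset sorted_sort_id)
  ultimately show "\<exists>c\<in>placements n m. z = sorted_list_of_multiset (placed n c)" by blast
qed

section \<open>Separating the two copies of each letter, and the shift by one block\<close>

text \<open>Entries with different letters differ, so a repetition can only come from two copies of
  one letter in the same block.\<close>

lemma distinct_placed:
  assumes "c \<in> placements n m"
  shows "distinct (sorted_list_of_multiset (placed n c)) \<longleftrightarrow> (\<forall>x\<in>{1..n}. fst (c x) < snd (c x))"
    (is "?L \<longleftrightarrow> ?R")
proof -
  let ?z = "sorted_list_of_multiset (placed n c)"
  have le: "fst (c x) \<le> snd (c x)" if "x \<in> {1..n}" for x
    using assms that by (auto simp: placements_def)
  have fil: "mset (filter (\<lambda>p. snd p = x) ?z) = {#(fst (c x), x), (snd (c x), x)#}"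
    if "x \<in> {1..n}" for x
    using filter_placed[OF that] by simp
  show ?thesis
  proof
    assume d: ?L
    show ?R
    proof
      fix x assume x: "x \<in> {1..n}"
      have "distinct (filter (\<lambda>p. snd p = x) ?z)" using d by simp
      then have "count (mset (filter (\<lambda>p. snd p = x) ?z)) (fst (c x), x) \<le> 1"
        unfolding distinct_count_atmost_1 by (metis order_refl zero_le_one)
      then have "fst (c x) \<noteq> snd (c x)" unfolding fil[OF x] by auto
      then show "fst (c x) < snd (c x)" using le[OF x] by simp
    qed
  next
    assume R: ?R
    show ?L unfolding distinct_count_atmost_1
    proof
      fix p
      show "count (mset ?z) p = (if p \<in> set ?z then 1 else 0)"
      proof (cases "p \<in> set ?z")
        case True
        then have x: "snd p \<in> {1..n}" by (auto simp: set_placed)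
        have "count (mset ?z) p = count (mset (filter (\<lambda>q. snd q = snd p) ?z)) p" by simp
        also have "\<dots> \<le> 1" unfolding fil[OF x] using bspec[OF R x] by (cases p) auto
        finally have "count (mset ?z) p \<le> 1" .
        moreover have "count (mset ?z) p > 0" using True by simp
        ultimately have "count (mset ?z) p = 1" by linarith
        then show ?thesis using True by simp
      next
        case False
        then show ?thesis by (simp add: not_in_iff)
      qed
    qed
  qed
qed

text \<open>Without bars there is a single block, which cannot separate the two copies of the letter
  1.\<close>

lemma distinct_sorted_barred_0:
  assumes "n \<ge> 1"
  shows "{z \<in> sorted_barred n 0. distinct z} = {}"
proof -
  have False if z: "z \<in> sorted_barred n 0" "distinct z" for z
  proof -
    obtain c where c: "c \<in> placements n 0" "z = sorted_list_of_multiset (placed n c)"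
      using z(1) bij_betw_placements[of n 0] by (auto simp: bij_betw_def)
    then have "fst (c 1) < snd (c 1)" using distinct_placed[OF c(1)] z(2) assms by auto
    then show False using c(1) assms by (auto simp: placements_def)
  qed
  then show ?thesis by blast
qed

text \<open>Lowering every second block by one turns \<open><\<close> into \<le> between the two
  blocks. The nonnesting condition compares second copies only with second copies, so a uniform
  shift preserves it.\<close>

lemma card_distinct_sorted_barred_Suc:
  "card {z \<in> sorted_barred n (Suc m). distinct z} = card (sorted_barred n m)"
proof -
  let ?f = "\<lambda>c. sorted_list_of_multiset (placed n c)"
  let ?K = "{c \<in> placements n (Suc m). \<forall>x\<in>{1..n}. fst (c x) < snd (c x)}"
  have "bij_betw ?f ?K {z \<in> sorted_barred n (Suc m). distinct z}"
    unfolding bij_betw_def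
  proof
    show "inj_on ?f ?K"
      using bij_betw_placements[of n "Suc m"] by (auto simp: bij_betw_def intro: inj_on_subset)
    have "sorted_barred n (Suc m) = ?f ` placements n (Suc m)"
      using bij_betw_placements[of n "Suc m"] by (simp add: bij_betw_def)
    then show "?f ` ?K = {z \<in> sorted_barred n (Suc m). distinct z}"
      using distinct_placed[of _ n "Suc m"] by auto
  qed
  then have "card {z \<in> sorted_barred n (Suc m). distinct z} = card ?K"
    by (simp add: bij_betw_same_card)
  also have "card ?K = card (placements n m)"
  proof -
    let ?dn = "\<lambda>c. \<lambda>x\<in>{1..n}. (fst (c x), snd (c x) - 1)"
    let ?up = "\<lambda>c. \<lambda>x\<in>{1..n}. (fst (c x), Suc (snd (c x)))"
    have "bij_betw ?dn ?K (placements n m)"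
    proof (rule bij_betw_byWitness[where f' = ?up])
      show "\<forall>c\<in>?K. ?up (?dn c) = c"
      proof (intro ballI ext)
        fix c x assume c: "c \<in> ?K"
        show "?up (?dn c) x = c x"
        proof (cases "x \<in> {1..n}")
          case True
          then have "fst (c x) < snd (c x)" using c by blast
          then show ?thesis using True by (simp add: prod_eq_iff)
        next
          case False
          have "c \<in> {1..n} \<rightarrow>\<^sub>E UNIV" using c by (simp add: placements_def)
          then have "c x = undefined" using False by (rule PiE_arb)
          then show ?thesis using False by (simp only: restrict_def if_False)
        qed
      qed
      show "\<forall>c\<in>placements n m. ?dn (?up c) = c"
        by (auto simp: placements_def PiE_def extensional_def fun_eq_iff prod_eq_iff)
      show "?dn ` ?K \<subseteq> placements n m"
      proof
        fix e assume "e \<in> ?dn ` ?K"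
        then obtain c where c: "c \<in> placements n (Suc m)" "\<forall>x\<in>{1..n}. fst (c x) < snd (c x)"
          and e: "e = ?dn c" by auto
        \<comment> \<open>Each second block exceeds a first block and is hence positive, so the
          truncated subtraction is exact.\<close>
        have shift: "(snd (c y) - 1, y) < (snd (c x) - 1, x) \<longleftrightarrow> (snd (c y), y) < (snd (c x), x)"
          if "x \<in> {1..n}" "y \<in> {1..n}" for x y
          unfolding less_prod_simp using bspec[OF c(2) that(1)] bspec[OF c(2) that(2)] by linarith
        have val: "e x = (fst (c x), snd (c x) - 1)" if "x \<in> {1..n}" for x
          using that by (simp add: e)
        have cond: "\<not> ((fst (c x), x) < (fst (c y), y) \<and> (snd (c y), y) < (snd (c x), x))"
          if "x \<in> {1..n}" "y \<in> {1..n}" for x y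
          using c(1) that unfolding placements_def by blast
        have bound: "fst (c x) \<le> snd (c x) - 1 \<and> snd (c x) - 1 \<le> m" if "x \<in> {1..n}" for x
        proof -
          have "snd (c x) \<le> Suc m" using c(1) that unfolding placements_def by blast
          then show ?thesis using bspec[OF c(2) that] by linarith
        qed
        have "e \<in> {1..n} \<rightarrow>\<^sub>E UNIV" unfolding e by simp
        then show "e \<in> placements n m"
          unfolding placements_def
          using shift cond bound by (simp del: less_prod_simp atLeastAtMost_iff add: val)
      qed
      show "?up ` placements n m \<subseteq> ?K"
      proof
        fix e assume "e \<in> ?up ` placements n m"
        then obtain c where c: "c \<in> placements n m" and e: "e = ?up c" by auto
        have shift: "(Suc (snd (c y)), y) < (Suc (snd (c x)), x) \<longleftrightarrow> (snd (c y), y) < (snd (c x), x)"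
          for x y by simp
        have val: "e x = (fst (c x), Suc (snd (c x)))" if "x \<in> {1..n}" for x
          using that by (simp add: e)
        have cond: "\<not> ((fst (c x), x) < (fst (c y), y) \<and> (snd (c y), y) < (snd (c x), x))"
          if "x \<in> {1..n}" "y \<in> {1..n}" for x y
          using c that unfolding placements_def by blast
        have bound: "fst (c x) \<le> snd (c x) \<and> snd (c x) \<le> m" if "x \<in> {1..n}" for x
          using c that unfolding placements_def by blast
        have "e \<in> {1..n} \<rightarrow>\<^sub>E UNIV" unfolding e by simp
        then show "e \<in> ?K"
          unfolding placements_def
          using shift cond bound
          by (simp del: less_prod_simp atLeastAtMost_iff add: val less_Suc_eq_le le_SucI)
      qed
    qed
    then show ?thesis by (rule bij_betw_same_card)
  qed
  also have "\<dots> = card (sorted_barred n m)"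
    using bij_betw_placements by (rule bij_betw_same_card)
  finally show ?thesis .
qed

section \<open>Equidistribution of weak descents and descents plus one\<close>

lemma length_nonnesting_perms: "\<pi> \<in> nonnesting_perms n \<Longrightarrow> length \<pi> = 2 * n"
  by (auto simp: nonnesting_perms_def permutations_of_multiset_def two_copies_def
      simp flip: size_mset)

lemma finite_nonnesting_perms: "finite (nonnesting_perms n)"
  by (simp add: nonnesting_perms_def)

text \<open>The union is disjoint, since forgetting the bars returns the permutation. All words have
  length 2n, so each summand depends only on the number of forced bars.\<close>

lemma card_UN_barred:
  "card (\<Union>\<pi>\<in>nonnesting_perms n. barred R \<pi> 0 m)
   = (\<Sum>\<pi>\<in>nonnesting_perms n. (Suc m - des_by R \<pi> + 2 * n - 1) choose (2 * n))"
proof -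
  have "card (\<Union>\<pi>\<in>nonnesting_perms n. barred R \<pi> 0 m)
      = (\<Sum>\<pi>\<in>nonnesting_perms n. card (barred R \<pi> 0 m))"
    by (rule card_UN_disjoint) (auto simp: finite_nonnesting_perms finite_barred, auto simp: barred_def)
  also have "\<dots> = (\<Sum>\<pi>\<in>nonnesting_perms n. (Suc m - des_by R \<pi> + 2 * n - 1) choose (2 * n))"
    by (rule sum.cong) (auto simp: card_barred length_nonnesting_perms)
  finally show ?thesis .
qed

lemma sorted_barred_eq_barred:
  "sorted_barred n m = (\<Union>\<pi>\<in>nonnesting_perms n. barred (>) \<pi> 0 m)"
proof -
  have "sorted z \<longleftrightarrow> successively (\<lambda>p q. fst p < fst q \<or> fst p = fst q \<and> \<not> snd p > snd q) z"
    for z :: "(nat \<times> nat) list"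
    by (subst successively_conv_sorted_wrt[symmetric])
      (auto intro!: successively_cong simp: less_eq_prod_def transp_def)
  then show ?thesis by (auto simp: sorted_barred_def barred_def)
qed

text \<open>Sorted and distinct means strictly sorted, so equal neighbouring letters also force a
  bar.\<close>

lemma distinct_sorted_barred_eq_barred:
  "{z \<in> sorted_barred n m. distinct z} = (\<Union>\<pi>\<in>nonnesting_perms n. barred (\<ge>) \<pi> 0 m)"
proof -
  have "sorted z \<and> distinct z \<longleftrightarrow>
      successively (\<lambda>p q. fst p < fst q \<or> fst p = fst q \<and> \<not> snd p \<ge> snd q) z"
    for z :: "(nat \<times> nat) list"
    unfolding strict_sorted_iff[symmetric]
    by (subst successively_conv_sorted_wrt[symmetric])
      (auto intro!: successively_cong simp: less_prod_def transp_def)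
  then show ?thesis by (auto simp: sorted_barred_def barred_def)
qed

text \<open>The extra \<open>Suc\<close> matches the loss of one bar in the shift: m bars for weak
  descents correspond to m - 1 bars for descents.\<close>

lemma weak_des_equidistributed:
  assumes "n \<ge> 1"
  shows "card {\<pi> \<in> nonnesting_perms n. Suc (des_by (>) \<pi>) = r}
       = card {\<pi> \<in> nonnesting_perms n. des_by (\<ge>) \<pi> = r}"
proof (rule equidistributed_if_sums_eq[where G = "\<lambda>q. (q + 2 * n - 1) choose (2 * n)"])
  fix m
  show "(\<Sum>\<pi>\<in>nonnesting_perms n. (Suc m - Suc (des_by (>) \<pi>) + 2 * n - 1) choose (2 * n))
      = (\<Sum>\<pi>\<in>nonnesting_perms n. (Suc m - des_by (\<ge>) \<pi> + 2 * n - 1) choose (2 * n))"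
  proof (cases m)
    case 0
    \<comment> \<open>For \<open>m = 0\<close> both sums vanish: the right one counts an empty set,
      and on the left each term is \<open>2 * n - 1 choose (2 * n)\<close>.\<close>
    have "(\<Sum>\<pi>\<in>nonnesting_perms n. (Suc 0 - des_by (\<ge>) \<pi> + 2 * n - 1) choose (2 * n)) = 0"
      unfolding card_UN_barred[symmetric] distinct_sorted_barred_eq_barred[symmetric]
        distinct_sorted_barred_0[OF assms] by simp
    then show ?thesis using 0 assms by simp
  next
    case (Suc k)
    have "card (sorted_barred n k) = card {z \<in> sorted_barred n (Suc k). distinct z}"
      by (simp add: card_distinct_sorted_barred_Suc)
    then show ?thesis
      unfolding distinct_sorted_barred_eq_barred unfolding sorted_barred_eq_barred card_UN_barred Suc
      by simp
  qed
qed (use assms finite_nonnesting_perms in auto)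

section \<open>Complementing the letters\<close>

lemma bij_betw_complement:
  "bij_betw (map (\<lambda>x. Suc n - x)) (nonnesting_perms n) (nonnesting_perms n)"
proof (rule bij_betw_byWitness[where f' = "map (\<lambda>x. Suc n - x)"])
  have set: "set \<pi> = {1..n}" if "\<pi> \<in> nonnesting_perms n" for \<pi>
  proof -
    have "set_mset (mset \<pi>) = set_mset (two_copies n)"
      using that by (simp add: nonnesting_perms_def permutations_of_multiset_def)
    then show ?thesis by (simp add: two_copies_def)
  qed
  show "\<forall>\<pi>\<in>nonnesting_perms n. map (\<lambda>x. Suc n - x) (map (\<lambda>x. Suc n - x) \<pi>) = \<pi>"
    by (auto intro!: map_idI simp: set)
  then show "\<forall>\<pi>\<in>nonnesting_perms n. map (\<lambda>x. Suc n - x) (map (\<lambda>x. Suc n - x) \<pi>) = \<pi>" .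
  have bij: "bij_betw (\<lambda>x. Suc n - x) {1..n} {1..n}"
    by (rule bij_betw_byWitness[where f' = "\<lambda>x. Suc n - x"]) auto
  have two: "image_mset (\<lambda>x. Suc n - x) (two_copies n) = two_copies n"
    using bij by (simp add: two_copies_def image_mset_mset_set bij_betw_def)
  show "map (\<lambda>x. Suc n - x) ` nonnesting_perms n \<subseteq> nonnesting_perms n"
  proof
    fix \<rho> assume "\<rho> \<in> map (\<lambda>x. Suc n - x) ` nonnesting_perms n"
    then obtain \<pi> where p: "\<pi> \<in> nonnesting_perms n" and r: "\<rho> = map (\<lambda>x. Suc n - x) \<pi>" by auto
    \<comment> \<open>Truncated subtraction is injective here because the letters lie in
      \<open>{1..n}\<close>. Nonnesting depends only on which letters are equal.\<close>
    have inj: "Suc n - \<pi> ! i = Suc n - \<pi> ! j \<longleftrightarrow> \<pi> ! i = \<pi> ! j"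
      if "i < length \<pi>" "j < length \<pi>" for i j
      using inj_on_eq_iff[OF bij_betw_imp_inj_on[OF bij]] that nth_mem set[OF p] by blast
    have "nonnesting \<rho>"
      unfolding nonnesting_def r
    proof (clarsimp)
      fix i j l m assume "i < j" "j < l" "l < m" "m < length \<pi>"
        "Suc n - \<pi> ! i = Suc n - \<pi> ! m" "Suc n - \<pi> ! j = Suc n - \<pi> ! l"
      moreover from this have "\<pi> ! i = \<pi> ! m" "\<pi> ! j = \<pi> ! l" using inj by simp_all
      moreover have "nonnesting \<pi>" using p by (simp add: nonnesting_perms_def)
      ultimately show False unfolding nonnesting_def by blast
    qed
    moreover have "mset \<rho> = two_copies n"
      using p two by (simp add: r nonnesting_perms_def permutations_of_multiset_def)
    ultimately show "\<rho> \<in> nonnesting_perms n"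
      by (simp add: nonnesting_perms_def permutations_of_multiset_def)
  qed
  then show "map (\<lambda>x. Suc n - x) ` nonnesting_perms n \<subseteq> nonnesting_perms n" .
qed

text \<open>Descents of the complement are the strict ascents of \<pi>, that is, those of the 2n - 1
  neighbouring pairs that are not weak descents.\<close>

lemma des_complement:
  assumes "\<pi> \<in> nonnesting_perms n" and "n \<ge> 1"
  shows "des_by (>) (map (\<lambda>x. Suc n - x) \<pi>) + des_by (\<ge>) \<pi> = 2 * n - 1"
proof -
  have "set_mset (mset \<pi>) = set_mset (two_copies n)"
    using assms by (simp add: nonnesting_perms_def permutations_of_multiset_def)
  then have set: "\<pi> ! i \<in> {1..n}" if "i < length \<pi>" for i
    using that nth_mem by (auto simp: two_copies_def)
  have "Suc n - x > Suc n - y \<longleftrightarrow> \<not> x \<ge> y" if "x \<in> {1..n}" "y \<in> {1..n}" for x y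
    using that by auto
  then have "des_by (>) (map (\<lambda>x. Suc n - x) \<pi>) = des_by (\<lambda>x y. \<not> x \<ge> y) \<pi>"
    unfolding des_by_map unfolding des_by_def
    by (intro arg_cong[where f = card] Collect_cong conj_cong refl) (use set in auto)
  then show ?thesis
    using des_by_compl[of "(\<ge>)" \<pi>] length_nonnesting_perms[OF assms(1)] by simp
qed

theorem corollary2p4:
  fixes n :: nat and r :: int
  assumes "n \<ge> 1"
  shows "card {\<pi> \<in> nonnesting_perms n. int (des \<pi>) = r}
       = card {\<pi> \<in> nonnesting_perms n. int (des \<pi>) = 2 * int n - 2 - r}"
proof -
  let ?C = "nonnesting_perms n" and ?f = "map (\<lambda>x. Suc n - x) :: nat list \<Rightarrow> nat list"
  have des: "des \<pi> = des_by (>) \<pi>" for \<pi> :: "nat list"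
    by (simp add: des_def des_by_def)
  have compl: "int (des (?f \<pi>)) = r \<longleftrightarrow> int (des_by (\<ge>) \<pi>) = 2 * int n - 1 - r"
    if "\<pi> \<in> ?C" for \<pi>
    using des_complement[OF that assms] assms unfolding des by linarith
  have "bij_betw ?f {\<pi> \<in> ?C. int (des_by (\<ge>) \<pi>) = 2 * int n - 1 - r} {\<pi> \<in> ?C. int (des \<pi>) = r}"
    unfolding bij_betw_def
  proof
    show "inj_on ?f {\<pi> \<in> ?C. int (des_by (\<ge>) \<pi>) = 2 * int n - 1 - r}"
      using bij_betw_complement[of n] by (auto simp: bij_betw_def intro: inj_on_subset)
    have img: "?f ` ?C = ?C" using bij_betw_complement[of n] by (simp add: bij_betw_def)
    show "?f ` {\<pi> \<in> ?C. int (des_by (\<ge>) \<pi>) = 2 * int n - 1 - r} = {\<pi> \<in> ?C. int (des \<pi>) = r}"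
      (is "?L = ?R")
    proof
      show "?L \<subseteq> ?R" using compl img by blast
      show "?R \<subseteq> ?L"
      proof
        fix \<rho> assume r: "\<rho> \<in> ?R"
        then obtain \<pi> where "\<pi> \<in> ?C" "\<rho> = ?f \<pi>" using img by blast
        then show "\<rho> \<in> ?L" using r compl by blast
      qed
    qed
  qed
  then have "card {\<pi> \<in> ?C. int (des \<pi>) = r}
      = card {\<pi> \<in> ?C. int (des_by (\<ge>) \<pi>) = 2 * int n - 1 - r}"
    by (simp add: bij_betw_same_card)
  also have "\<dots> = card {\<pi> \<in> ?C. int (Suc (des_by (>) \<pi>)) = 2 * int n - 1 - r}"
  \<comment> \<open>The equidistribution is stated for natural values; for a negative value both
    sets are empty.\<close>
  proof (cases "2 * int n - 1 - r \<ge> 0")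
    case True
    then obtain s where "2 * int n - 1 - r = int s" by (metis nonneg_int_cases)
    then show ?thesis using weak_des_equidistributed[OF assms, of s] by (simp del: of_nat_Suc)
  next
    case False
    then show ?thesis
      by (metis (no_types, lifting) of_nat_0_le_iff)
  qed
  \<comment> \<open>Removing the \<open>Suc\<close> changes 2n - 1 - r into 2n - 2 - r.\<close>
  also have "\<dots> = card {\<pi> \<in> ?C. int (des \<pi>) = 2 * int n - 2 - r}"
    by (intro arg_cong[where f = card]) (auto simp: des)
  finally show ?thesis .
qed

end
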